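(* For every integer $n \geq 0$, $$\int_{0}^{1} x^{n} e^{-x}\, dx = \frac{n!}{e} \left( e - \sum_{k=0}^{n} \frac{1}{k!} \right).$$ *)

theory Defs imports "HOL-Analysis.Analysis" begin

end

theory Submission imports Defs begin

text \<open>Let S_n be the n-th Taylor polynomial of exp at 0. Differentiating e^(-x) S_n(x)
  telescopes, because S_n' and S_n differ only by x^n / n!. Hence -n! e^(-x) S_n(x) is an
  antiderivative of x^n e^(-x), and the fundamental theorem of calculus gives the integral as n! (1
  - S_n(1)/e).\<close>

lemma has_real_derivative_exp_minus_times_exp_partial_sum:
  fixes x :: real
  shows "((\<lambda>x. exp (- x) * (\<Sum>k=0..n. x ^ k / fact k))
            has_real_derivative - (x ^ n * exp (- x) / fact n)) (at x)"
proof (induction n)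
  case 0
  show ?case
    by (auto intro!: derivative_eq_intros)
next
  case (Suc n)
  have "((\<lambda>x. exp (- x) * (x ^ Suc n / fact (Suc n))) has_real_derivative
          - exp (- x) * (x ^ Suc n / fact (Suc n))
          + exp (- x) * (real (Suc n) * x ^ n / fact (Suc n))) (at x)"
    by (rule derivative_eq_intros refl | simp)+
  \<comment> \<open>With this, the second summand of the product rule cancels the derivative from
    \<open>Suc.IH\<close>; only the term of degree \<open>Suc n\<close> survives.\<close>
  moreover have "real (Suc n) * x ^ n / fact (Suc n) = x ^ n / fact n"
    by (simp add: divide_simps del: of_nat_Suc)
  ultimately show ?case
    using DERIV_add[OF Suc.IH] by (fastforce simp: distrib_left mult.commute)
qed

theorem proposition3p2:
  fixes n :: nat
  shows "integral {0..1} (\<lambda>x::real. x ^ n * exp (- x))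
       = fact n / exp 1 * (exp 1 - (\<Sum>k=0..n. 1 / fact k))"
proof -
  define F :: "real \<Rightarrow> real"
    where "F x = - fact n * (exp (- x) * (\<Sum>k=0..n. x ^ k / fact k))" for x
  have "(F has_real_derivative x ^ n * exp (- x)) (at x)" for x
    unfolding F_def
    using DERIV_cmult[OF has_real_derivative_exp_minus_times_exp_partial_sum, of "- fact n" n x]
    by simp
  then have "((\<lambda>x. x ^ n * exp (- x)) has_integral F 1 - F 0) {0..1}"
    by (intro fundamental_theorem_of_calculus)
       (auto simp flip: has_real_derivative_iff_has_vector_derivative
             intro: has_field_derivative_at_within)
  \<comment> \<open>Only k = 0 contributes, since \<open>0 ^ 0 = 1\<close>; so \<open>F 0\<close> is
    \<open>- fact n\<close>.\<close>
  moreover have "(\<Sum>k=0..n. (0::real) ^ k / fact k) = 1"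
    by (induction n) simp_all
  then have "F 1 - F 0 = fact n / exp 1 * (exp 1 - (\<Sum>k=0..n. 1 / fact k))"
    by (simp add: F_def exp_minus field_simps)
  ultimately show ?thesis
    by (simp add: integral_unique)
qed

end
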